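(* For each integer $n\ge 1$ let $B_n^2$ be the strong prism of the linear polyomino chain $B_n$ with $n$ squares. Then $$\lim_{n\to\infty}\frac{Kf^*(B_n^2)}{Gut(B_n^2)}=\frac{1}{8},$$ where $Kf^*$ denotes the degree-Kirchhoff index and $Gut$ denotes the Gutman index.
   Context: All graphs are simple and undirected. The linear polyomino chain $B_n$ with $n$ squares is the graph with $2n+2$ vertices $u_1,\dots,u_{n+1},v_1,\dots,v_{n+1}$ and $3n+1$ edges: $u_iu_{i+1}$ and $v_iv_{i+1}$ for $1\le i\le n$, and $u_iv_i$ for $1\le i\le n+1$. The strong product $G\boxtimes H$ of graphs $G$ and $H$ has vertex set $V(G)\times V(H)$, where two distinct vertices $(a_1,b_1)$ and $(a_2,b_2)$ are adjacent whenever $a_1,a_2$ are equal or adjacent in $G$ and $b_1,b_2$ are equal or adjacent in $H$. The strong prism of $G$ is the strong product of $G$ and $K_2$ (the complete graph on two vertices). $B_n^2$ denotes the strong prism of $B_n$; it has $4n+4$ vertices and $2(7n+3)$ edges. For a connected graph $G$ with vertices labeled $1,\dots,N$, let $d_i$ be the degree of vertex $i$, let $d_{ij}$ be the length of a shortest path between $i$ and $j$, and let $r_{ij}$ be the resistance distance between $i$ and $j$, i.e. the effective resistance between $i$ and $j$ in the electrical network obtained by placing a unit resistor on each edge of $G$. The degree-Kirchhoff index is $Kf^*(G)=\sum_{i<j}d_id_jr_{ij}$ and the Gutman index is $Gut(G)=\sum_{i<j}d_id_jd_{ij}$. *)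

theory Defs
  imports Complex_Main "Graph_Theory.Graph_Theory"
begin

text \<open>
  A simple undirected graph is a finite symmetric loopless digraph without parallel arcs
  (\<^locale>\<open>pair_graph\<close>): the edge $xy$ is the pair of arcs $(x,y)$ and $(y,x)$. In particular the
  degree of a vertex is its out-degree.
\<close>

datatype ladder_vertex = U nat | V nat

text \<open>\<^term>\<open>symcl\<close>, written with a superscript s, adds the reversed arcs.\<close>

definition polyomino_chain :: "nat \<Rightarrow> ladder_vertex pair_pre_digraph" where
  "polyomino_chain n =
    \<lparr> pverts = U ` {1..n+1} \<union> V ` {1..n+1},
      parcs = symcl ({(U i, U (i+1)) | i. 1 \<le> i \<and> i \<le> n}
                   \<union> {(V i, V (i+1)) | i. 1 \<le> i \<and> i \<le> n}
                   \<union> {(U i, V i) | i. 1 \<le> i \<and> i \<le> n+1}) \<rparr>"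

definition strong_product ::
    "'a pair_pre_digraph \<Rightarrow> 'b pair_pre_digraph \<Rightarrow> ('a \<times> 'b) pair_pre_digraph" where
  "strong_product G H =
    \<lparr> pverts = pverts G \<times> pverts H,
      parcs = {(p, q). p \<in> pverts G \<times> pverts H \<and> q \<in> pverts G \<times> pverts H \<and> p \<noteq> q
        \<and> (fst p = fst q \<or> (fst p, fst q) \<in> parcs G)
        \<and> (snd p = snd q \<or> (snd p, snd q) \<in> parcs H)} \<rparr>"

definition complete_two :: "bool pair_pre_digraph" where
  "complete_two = \<lparr> pverts = UNIV, parcs = {(a, b). a \<noteq> b} \<rparr>"

definition strong_prism :: "'a pair_pre_digraph \<Rightarrow> ('a \<times> bool) pair_pre_digraph" where
  "strong_prism G = strong_product G complete_two"

text \<open>Weighted distance of the library with all arc weights equal to one.\<close>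

definition graph_distance :: "'a pair_pre_digraph \<Rightarrow> 'a \<Rightarrow> 'a \<Rightarrow> real" where
  "graph_distance G x y = real_of_ereal (wf_digraph.\<mu> (with_proj G) (\<lambda>_. 1) x y)"

text \<open>
  \<open>\<phi>\<close> is a potential for the unit current from \<open>x\<close> to \<open>y\<close>. By Ohm's law, the current
  from \<open>z\<close> to a neighbour \<open>w\<close> through the unit resistor \<open>zw\<close> is \<open>\<phi> z - \<phi> w\<close>; by Kirchhoff's
  current law, the net current out of \<open>z\<close> is what is injected there from outside.
\<close>

definition unit_current_potential ::
    "'a pair_pre_digraph \<Rightarrow> 'a \<Rightarrow> 'a \<Rightarrow> ('a \<Rightarrow> real) \<Rightarrow> bool" where
  "unit_current_potential G x y \<phi> \<longleftrightarrow>
    (\<forall>z\<in>pverts G. (\<Sum>w | (z, w) \<in> parcs G. \<phi> z - \<phi> w) = of_bool (z = x) - of_bool (z = y))"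

text \<open>
  The potential difference that drives a unit current from \<open>x\<close> to \<open>y\<close>. In a finite connected
  graph a potential exists and is unique up to an additive constant, so the description is proper.
\<close>

definition resistance_distance :: "'a pair_pre_digraph \<Rightarrow> 'a \<Rightarrow> 'a \<Rightarrow> real" where
  "resistance_distance G x y =
    (THE R. \<exists>\<phi>. unit_current_potential G x y \<phi> \<and> R = \<phi> x - \<phi> y)"

text \<open>
  A sum over unordered pairs of distinct vertices: summing a symmetric function over ordered pairs
  counts each of them twice. The lemmas \<open>degree_Kirchhoff_index_labelled\<close> and
  \<open>Gutman_index_labelled\<close> below give the form with vertices labelled from 1 to N.
\<close>

definition sum_vertex_pairs :: "'a pair_pre_digraph \<Rightarrow> ('a \<Rightarrow> 'a \<Rightarrow> real) \<Rightarrow> real" where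
  "sum_vertex_pairs G f = (\<Sum>x\<in>pverts G. \<Sum>y\<in>pverts G - {x}. f x y) / 2"

definition degree_Kirchhoff_index :: "'a pair_pre_digraph \<Rightarrow> real" where
  "degree_Kirchhoff_index G =
    sum_vertex_pairs G (\<lambda>x y. real (out_degree (with_proj G) x) * real (out_degree (with_proj G) y)
      * resistance_distance G x y)"

definition Gutman_index :: "'a pair_pre_digraph \<Rightarrow> real" where
  "Gutman_index G =
    sum_vertex_pairs G (\<lambda>x y. real (out_degree (with_proj G) x) * real (out_degree (with_proj G) y)
      * graph_distance G x y)"

lemma sum_vertex_pairs_labelled:
  fixes l :: "nat \<Rightarrow> 'a"
  assumes l: "bij_betw l {1..N} (pverts G)"
    and sym: "\<And>x y. x \<in> pverts G \<Longrightarrow> y \<in> pverts G \<Longrightarrow> f x y = f y x"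
  shows "sum_vertex_pairs G f = (\<Sum>(i, j) | 1 \<le> i \<and> i < j \<and> j \<le> N. f (l i) (l j))"
proof -
  define g where "g = (\<lambda>(i, j). f (l i) (l j))"
  define A where "A = {(i, j). 1 \<le> i \<and> i < j \<and> j \<le> N}"
  have fin: "finite A"
    by (rule finite_subset[of _ "{1..N} \<times> {1..N}"]) (auto simp: A_def)
  have inj: "inj_on l {1..N}" and im: "l ` {1..N} = pverts G"
    using l by (auto simp: bij_betw_def)
  have inner: "(\<Sum>y\<in>pverts G - {l i}. f (l i) y) = (\<Sum>j\<in>{1..N} - {i}. g (i, j))"
    if "i \<in> {1..N}" for i
  proof -
    have "pverts G - {l i} = l ` ({1..N} - {i})"
      using inj_on_image_set_diff[OF inj, of "{1..N}" "{i}"] that im by simp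
    moreover have "inj_on l ({1..N} - {i})"
      using inj by (rule inj_on_subset) auto
    ultimately show ?thesis
      by (simp add: sum.reindex g_def)
  qed
  have "(\<Sum>x\<in>pverts G. \<Sum>y\<in>pverts G - {x}. f x y)
      = (\<Sum>i\<in>{1..N}. \<Sum>y\<in>pverts G - {l i}. f (l i) y)"
    by (rule sum.reindex_bij_betw[OF l, symmetric])
  also have "\<dots> = (\<Sum>i\<in>{1..N}. \<Sum>j\<in>{1..N} - {i}. g (i, j))"
    by (rule sum.cong[OF refl inner])
  also have "\<dots> = sum g (SIGMA i:{1..N}. {1..N} - {i})"
    by (subst sum.Sigma) auto
  also have "(SIGMA i:{1..N}. {1..N} - {i}) = A \<union> prod.swap ` A"
  proof (rule set_eqI)
    fix p :: "nat \<times> nat"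
    obtain i j where p: "p = (i, j)" by (cases p)
    have "p \<in> prod.swap ` A \<longleftrightarrow> (j, i) \<in> A"
      unfolding p by (metis image_iff swap_simp swap_swap)
    then show "p \<in> (SIGMA i:{1..N}. {1..N} - {i}) \<longleftrightarrow> p \<in> A \<union> prod.swap ` A"
      by (auto simp: p A_def)
  qed
  also have "sum g \<dots> = sum g A + sum g (prod.swap ` A)"
    using fin by (intro sum.union_disjoint) (auto simp: A_def)
  also have "sum g (prod.swap ` A) = sum (g \<circ> prod.swap) A"
    by (rule sum.reindex) auto
  also have "\<dots> = sum g A"
  proof (rule sum.cong)
    fix p assume "p \<in> A"
    then obtain i j where p: "p = (i, j)" and "i \<in> {1..N}" "j \<in> {1..N}"
      by (auto simp: A_def)
    then have "f (l j) (l i) = f (l i) (l j)"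
      using im by (intro sym) blast+
    then show "(g \<circ> prod.swap) p = g p"
      by (simp add: p g_def)
  qed simp
  finally show ?thesis
    by (simp add: sum_vertex_pairs_def g_def A_def)
qed

lemma resistance_distance_commute: "resistance_distance G x y = resistance_distance G y x"
proof -
  have *: "unit_current_potential G y x (\<lambda>z. - \<phi> z)"
    if "unit_current_potential G x y \<phi>" for \<phi> x y
    using that unfolding unit_current_potential_def
    by (auto simp: sum_subtractf sum_negf)
  have **: "\<exists>\<phi>. unit_current_potential G y x \<phi> \<and> R = \<phi> y - \<phi> x"
    if "\<exists>\<phi>. unit_current_potential G x y \<phi> \<and> R = \<phi> x - \<phi> y" for R x y
  proof -
    from that obtain \<phi> where "unit_current_potential G x y \<phi>" "R = \<phi> x - \<phi> y"
      by blast
    then show ?thesis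
      using *[of x y \<phi>] by (intro exI[of _ "\<lambda>z. - \<phi> z"]) simp
  qed
  show ?thesis
    unfolding resistance_distance_def
    by (rule arg_cong[where f = The]) (intro ext iffI; erule **)
qed

lemma (in pair_graph) graph_distance_commute: "graph_distance G x y = graph_distance G y x"
proof -
  have rev: "\<exists>q. awalk y q x \<and> awalk_cost (\<lambda>_. 1) q = awalk_cost (\<lambda>_. 1) p"
    if "awalk x p y" for p x y
    using that
  proof (induction p arbitrary: x)
    case Nil
    then show ?case
      by (auto simp: awalk_Nil_iff intro!: exI[of _ "[]"])
  next
    case (Cons e p)
    from Cons.prems have e: "e \<in> parcs G" "fst e = x" and p: "awalk (snd e) p y"
      by (auto simp: awalk_Cons_iff)
    from Cons.IH[OF p] obtain q where
      q: "awalk y q (snd e)" "awalk_cost (\<lambda>_. 1) q = awalk_cost (\<lambda>_. 1) p"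
      by blast
    have "(snd e, x) \<in> parcs G"
      using e symD[of "parcs G" x "snd e"] pair_sym_arcs by (auto simp: symmetric_def)
    then have "awalk (snd e) [(snd e, x)] x"
      using arc_implies_awalk by fastforce
    with q(1) have "awalk y (q @ [(snd e, x)]) x"
      by (rule awalk_appendI)
    with q(2) show ?case
      by (intro exI[of _ "q @ [(snd e, x)]"]) simp
  qed
  have le: "\<mu> (\<lambda>_. 1) y x \<le> \<mu> (\<lambda>_. 1) x y" for x y
    unfolding \<mu>_def
  proof (rule INF_mono)
    fix p assume "p \<in> {p. awalk x p y}"
    with rev obtain q where "awalk y q x" "awalk_cost (\<lambda>_. 1) q = awalk_cost (\<lambda>_. 1) p"
      by blast
    then show "\<exists>q\<in>{p. awalk y p x}.
        ereal (awalk_cost (\<lambda>_. 1) q) \<le> ereal (awalk_cost (\<lambda>_. 1) p)"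
      by auto
  qed
  have "\<mu> (\<lambda>_. 1) x y = \<mu> (\<lambda>_. 1) y x"
    by (rule antisym[OF le le])
  then show ?thesis
    by (simp add: graph_distance_def)
qed

lemma degree_Kirchhoff_index_labelled:
  fixes l :: "nat \<Rightarrow> 'a"
  assumes "bij_betw l {1..N} (pverts G)"
  shows "degree_Kirchhoff_index G = (\<Sum>(i, j) | 1 \<le> i \<and> i < j \<and> j \<le> N.
    real (out_degree (with_proj G) (l i)) * real (out_degree (with_proj G) (l j))
      * resistance_distance G (l i) (l j))"
  unfolding degree_Kirchhoff_index_def
  by (rule sum_vertex_pairs_labelled[OF assms]) (simp add: resistance_distance_commute mult.commute)

lemma (in pair_graph) Gutman_index_labelled:
  fixes l :: "nat \<Rightarrow> 'a"
  assumes "bij_betw l {1..N} (pverts G)"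
  shows "Gutman_index G = (\<Sum>(i, j) | 1 \<le> i \<and> i < j \<and> j \<le> N.
    real (out_degree (with_proj G) (l i)) * real (out_degree (with_proj G) (l j))
      * graph_distance G (l i) (l j))"
  unfolding Gutman_index_def
  by (rule sum_vertex_pairs_labelled[OF assms]) (simp add: graph_distance_commute mult.commute)

lemma pair_graph_polyomino_chain: "pair_graph (polyomino_chain n)"
proof
  let ?G = "polyomino_chain n"
  show fst: "\<And>e. e \<in> parcs ?G \<Longrightarrow> fst e \<in> pverts ?G"
    and snd: "\<And>e. e \<in> parcs ?G \<Longrightarrow> snd e \<in> pverts ?G"
    by (auto simp: polyomino_chain_def symcl_def)
  show fin: "finite (pverts ?G)"
    by (simp add: polyomino_chain_def)
  have "parcs ?G \<subseteq> pverts ?G \<times> pverts ?G"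
    by (intro subsetI) (simp add: mem_Times_iff fst snd)
  then show "finite (parcs ?G)"
    using fin finite_subset by blast
  show "\<And>e. e \<in> parcs ?G \<Longrightarrow> fst e \<noteq> snd e"
    by (auto simp: polyomino_chain_def symcl_def)
  show "symmetric (with_proj ?G)"
  proof -
    have "sym (symcl R)" for R :: "ladder_vertex rel"
      by (auto simp: sym_def symcl_def)
    then show ?thesis
      by (simp add: symmetric_def polyomino_chain_def)
  qed
qed

lemma pair_graph_strong_prism:
  assumes "pair_graph G"
  shows "pair_graph (strong_prism G)"
proof -
  interpret pair_graph G by fact
  have sym_iff: "(y, x) \<in> parcs G \<longleftrightarrow> (x, y) \<in> parcs G" for x y
    using symD[of "parcs G"] pair_sym_arcs by (auto simp: symmetric_def)
  show ?thesis
  proof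
    let ?G = "strong_prism G"
    show fst: "\<And>e. e \<in> parcs ?G \<Longrightarrow> fst e \<in> pverts ?G"
      and snd: "\<And>e. e \<in> parcs ?G \<Longrightarrow> snd e \<in> pverts ?G"
      by (auto simp: strong_prism_def strong_product_def)
    show fin: "finite (pverts ?G)"
      by (simp add: strong_prism_def strong_product_def complete_two_def pair_finite_verts)
    have "parcs ?G \<subseteq> pverts ?G \<times> pverts ?G"
      by (intro subsetI) (simp add: mem_Times_iff fst snd)
    then show "finite (parcs ?G)"
      using fin finite_subset by blast
    show "\<And>e. e \<in> parcs ?G \<Longrightarrow> fst e \<noteq> snd e"
      by (auto simp: strong_prism_def strong_product_def)
    show "symmetric (with_proj ?G)"
      by (auto simp: symmetric_def sym_def strong_prism_def strong_product_def complete_two_def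
          sym_iff)
  qed
qed

end

theory Submission
  imports Defs
begin

text \<open>
  Resistance distance and graph distance in the strong prism of the ladder are both, up to a bounded
  error, functions of the number \<open>D\<close> of columns between two vertices: the distance is \<open>D\<close> and
  the resistance is \<open>D / 8\<close>, as neighbouring columns are joined by eight parallel unit
  resistors (lemmas \<open>prism_chain_distance\<close> and \<open>prism_chain_resistance\<close>). Degrees are
  bounded, so the degree-Kirchhoff index and one eighth of the Gutman index differ by a quantity of
  quadratic order in \<open>n\<close>, one bounded term for each pair of vertices. The Gutman index itself is
  of cubic order, so the ratio tends to \<open>1 / 8\<close>.

  The estimate of the resistance rests on an explicit potential. The Laplacian commutes with the
  exchange of each vertex with its twin and with the exchange of the two rows of the ladder. A unit
  source therefore splits into three parts: one that is constant on columns, where the potential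
  solves an equation on a path and is linear on either side of the source; one that is
  antisymmetric in the rows, where the rungs add a mass term that keeps the potential bounded; and
  one that is antisymmetric in the twins, where the potential is supported on the source and its
  twin. All sources share the same sinks at the ends of the ladder, so subtracting the potentials of
  two sources gives a potential for the unit current between them. By the maximum principle on a
  connected graph, this potential determines the resistance.
\<close>

section \<open>Harmonic functions and effective resistance\<close>

definition laplacian :: "'a pair_pre_digraph \<Rightarrow> ('a \<Rightarrow> real) \<Rightarrow> 'a \<Rightarrow> real" where
  "laplacian G f z = (\<Sum>w | (z, w) \<in> parcs G. f z - f w)"

definition neighbours :: "'a pair_pre_digraph \<Rightarrow> 'a \<Rightarrow> 'a set" where
  "neighbours G z = {w. (z, w) \<in> parcs G}"

lemma laplacian_neighbours: "laplacian G f z = (\<Sum>w\<in>neighbours G z. f z - f w)"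
  by (simp add: laplacian_def neighbours_def)

lemma laplacian_add: "laplacian G (\<lambda>z. f z + g z) z = laplacian G f z + laplacian G g z"
  by (simp add: laplacian_def sum.distrib[symmetric] algebra_simps)

lemma laplacian_diff: "laplacian G (\<lambda>z. f z - g z) z = laplacian G f z - laplacian G g z"
  by (simp add: laplacian_def sum_subtractf[symmetric] algebra_simps)

lemma laplacian_mult: "laplacian G (\<lambda>z. c * f z) z = c * laplacian G f z"
  by (simp add: laplacian_def sum_distrib_left algebra_simps)

lemma (in pair_graph) finite_neighbours: "finite (neighbours G z)"
proof (rule finite_subset)
  show "neighbours G z \<subseteq> snd ` parcs G"
    by (force simp: neighbours_def)
qed simp

text \<open>
  The maximum principle: at a vertex where \<open>g\<close> is maximal, the differences to the neighbours are
  nonnegative and sum to zero, so the maximum spreads to all neighbours and along every walk.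
\<close>

lemma (in pair_graph) harmonic_imp_constant:
  assumes conn: "\<And>x y. x \<in> pverts G \<Longrightarrow> y \<in> pverts G \<Longrightarrow> (x, y) \<in> (parcs G)\<^sup>*"
    and harm: "\<And>z. z \<in> pverts G \<Longrightarrow> laplacian G g z = 0"
    and x: "x \<in> pverts G" and y: "y \<in> pverts G"
  shows "g x = g y"
proof -
  define M where "M = Max (g ` pverts G)"
  have le: "g z \<le> M" if "z \<in> pverts G" for z
    using that by (simp add: M_def pair_finite_verts)
  obtain m where m: "m \<in> pverts G" "g m = M"
    using Max_in[of "g ` pverts G"] x pair_finite_verts unfolding M_def
    by (metis empty_iff finite_imageI image_iff)
  have *: "g w = M" if "(z, w) \<in> parcs G" "g z = M" for z w
  proof -
    have z: "z \<in> pverts G"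
      using arc_fst_in_verts[OF that(1)] by simp
    have nn: "0 \<le> g z - g b" if "b \<in> neighbours G z" for b
      using le[of b] arc_snd_in_verts[of "(z, b)"] that \<open>g z = M\<close> by (simp add: neighbours_def)
    have "(\<Sum>b\<in>neighbours G z. g z - g b) = 0"
      using harm[OF z] by (simp add: laplacian_neighbours)
    then have "\<forall>b\<in>neighbours G z. g z - g b = 0"
      using sum_nonneg_eq_0_iff[OF finite_neighbours, of z "\<lambda>b. g z - g b"] nn by blast
    then show ?thesis
      using that by (simp add: neighbours_def)
  qed
  have "g z = M" if "(m, z) \<in> (parcs G)\<^sup>*" for z
    using that
  proof induction
    case (step y z)
    show ?case by (rule *[OF step.hyps(2) step.IH])
  qed (rule m(2))
  then show ?thesis
    using conn[OF m(1)] x y by metis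
qed

text \<open>
  The difference of two potentials for the same current is harmonic, hence constant. Any one
  explicit potential therefore computes the resistance.
\<close>

lemma (in pair_graph) resistance_distance_eqI:
  assumes conn: "\<And>x y. x \<in> pverts G \<Longrightarrow> y \<in> pverts G \<Longrightarrow> (x, y) \<in> (parcs G)\<^sup>*"
    and x: "x \<in> pverts G" and y: "y \<in> pverts G"
    and pot: "unit_current_potential G x y \<phi>"
  shows "resistance_distance G x y = \<phi> x - \<phi> y"
  unfolding resistance_distance_def
proof (rule the_equality)
  show "\<exists>\<psi>. unit_current_potential G x y \<psi> \<and> \<phi> x - \<phi> y = \<psi> x - \<psi> y"
    using pot by blast
next
  fix R assume "\<exists>\<psi>. unit_current_potential G x y \<psi> \<and> R = \<psi> x - \<psi> y"
  then obtain \<psi> where \<psi>: "unit_current_potential G x y \<psi>" "R = \<psi> x - \<psi> y"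
    by blast
  have "laplacian G (\<lambda>z. \<psi> z - \<phi> z) z = 0" if "z \<in> pverts G" for z
    using \<psi>(1) pot that
    unfolding laplacian_diff unit_current_potential_def by (simp add: laplacian_def)
  from harmonic_imp_constant[OF conn this x y] show "R = \<phi> x - \<phi> y"
    using \<psi>(2) by simp
qed

text \<open>
  A potential for the unit current that enters at \<open>x\<close> and leaves through all vertices according
  to the distribution \<open>c\<close>. With \<open>c\<close> independent of \<open>x\<close>, potentials for different
  sources can be subtracted, and a single family indexed by one vertex yields all pairs.
\<close>

definition grounded_potential ::
    "'a pair_pre_digraph \<Rightarrow> ('a \<Rightarrow> real) \<Rightarrow> 'a \<Rightarrow> ('a \<Rightarrow> real) \<Rightarrow> bool" where
  "grounded_potential G c x \<phi> \<longleftrightarrow> (\<forall>z\<in>pverts G. laplacian G \<phi> z = of_bool (z = x) - c z)"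

lemma unit_current_potential_superposition:
  assumes "grounded_potential G c x \<phi>" "grounded_potential G c y \<psi>"
  shows "unit_current_potential G x y (\<lambda>z. \<phi> z - \<psi> z)"
  using assms laplacian_diff[of G \<phi> \<psi>]
  by (auto simp: unit_current_potential_def grounded_potential_def laplacian_def)

section \<open>Potentials on a strong prism\<close>

lemma pverts_strong_prism: "pverts (strong_prism G) = pverts G \<times> UNIV"
  by (simp add: strong_prism_def strong_product_def complete_two_def)

lemma (in pair_graph) neighbours_strong_prism:
  assumes "a \<in> pverts G"
  shows "neighbours (strong_prism G) (a, s) = insert (a, \<not> s) (neighbours G a \<times> UNIV)"
proof -
  have "b \<in> pverts G" if "(a, b) \<in> parcs G" for b
    using arc_snd_in_verts[OF that] by simp
  moreover have "(a, a) \<notin> parcs G"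
    using pair_no_loops[of "(a, a)"] by auto
  ultimately show ?thesis
    using assms
    by (auto simp: neighbours_def strong_prism_def strong_product_def complete_two_def)
qed

lemma (in pair_graph) sum_neighbours_strong_prism:
  fixes f :: "'a \<times> bool \<Rightarrow> 'b::comm_monoid_add"
  assumes "a \<in> pverts G"
  shows "(\<Sum>w\<in>neighbours (strong_prism G) (a, s). f w)
    = f (a, \<not> s) + (\<Sum>b\<in>neighbours G a. f (b, s) + f (b, \<not> s))"
proof -
  have UN: "(UNIV :: bool set) = {s, \<not> s}"
    by auto
  have "a \<notin> neighbours G a"
    using pair_no_loops[of "(a, a)"] by (auto simp: neighbours_def)
  then have "(\<Sum>w\<in>neighbours (strong_prism G) (a, s). f w)
      = f (a, \<not> s) + (\<Sum>w\<in>neighbours G a \<times> UNIV. f w)"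
    unfolding neighbours_strong_prism[OF assms] by (subst sum.insert) (auto simp: finite_neighbours)
  also have "(\<Sum>w\<in>neighbours G a \<times> UNIV. f w) = (\<Sum>b\<in>neighbours G a. \<Sum>t\<in>UNIV. f (b, t))"
    by (simp add: sum.cartesian_product)
  also have "\<dots> = (\<Sum>b\<in>neighbours G a. f (b, s) + f (b, \<not> s))"
    unfolding UN by simp
  finally show ?thesis .
qed

text \<open>
  The two copies of a vertex are twins. Hence the Laplacian of the prism respects the splitting of
  functions into those that agree on twins and those that change sign between them: it acts as
  twice the Laplacian of \<open>G\<close> on the former and as multiplication by a function on the latter.
\<close>

lemma (in pair_graph) laplacian_strong_prism_lift:
  assumes "a \<in> pverts G"
  shows "laplacian (strong_prism G) (\<lambda>p. g (fst p)) (a, s) = 2 * laplacian G g a"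
  unfolding laplacian_neighbours sum_neighbours_strong_prism[OF assms]
  by (simp add: sum_distrib_left)

definition sheet_sign :: "bool \<Rightarrow> real" where
  "sheet_sign s = (if s then 1 else -1)"

lemma (in pair_graph) laplacian_strong_prism_alternating:
  assumes "a \<in> pverts G"
  shows "laplacian (strong_prism G) (\<lambda>p. sheet_sign (snd p) * e (fst p)) (a, s)
    = 2 * (real (card (neighbours G a)) + 1) * (sheet_sign s * e a)"
  unfolding laplacian_neighbours sum_neighbours_strong_prism[OF assms]
  by (simp add: sheet_sign_def algebra_simps)

text \<open>
  The unit source at \<open>(a, s)\<close> is half the lift of the source at \<open>a\<close> plus half an
  alternating function supported on the two copies of \<open>a\<close>. Each half is inverted separately.
\<close>

lemma (in pair_graph) grounded_potential_strong_prism: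
  assumes pot: "grounded_potential G c a g"
  shows "grounded_potential (strong_prism G) (\<lambda>p. c (fst p) / 2) (a, s)
    (\<lambda>p. g (fst p) / 4
       + sheet_sign s * sheet_sign (snd p) * of_bool (fst p = a)
          / (4 * (real (card (neighbours G a)) + 1)))"
  unfolding grounded_potential_def
proof
  fix z assume "z \<in> pverts (strong_prism G)"
  then obtain b t where z: "z = (b, t)" and b: "b \<in> pverts G"
    by (auto simp: pverts_strong_prism)
  define k where "k = real (card (neighbours G a)) + 1"
  have k: "k > 0" by (simp add: k_def)
  define e where "e b = of_bool (b = a) * sheet_sign s / (4 * k)" for b
  have "laplacian (strong_prism G) (\<lambda>p. 1/4 * g (fst p) + sheet_sign (snd p) * e (fst p)) (b, t)
    = 1/4 * (2 * laplacian G g b) + 2 * (real (card (neighbours G b)) + 1) * (sheet_sign t * e b)"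
    unfolding laplacian_add laplacian_mult laplacian_strong_prism_lift[OF b]
      laplacian_strong_prism_alternating[OF b] ..
  also have "2 * (real (card (neighbours G b)) + 1) * (sheet_sign t * e b)
      = sheet_sign t * sheet_sign s * of_bool (b = a) / 2"
  proof (cases "b = a")
    case True
    then have "2 * (real (card (neighbours G b)) + 1) * (sheet_sign t * e b)
        = 2 * k * (sheet_sign t * (sheet_sign s / (4 * k)))"
      by (simp add: e_def k_def)
    then show ?thesis
      using k True by (simp add: field_simps)
  qed (simp add: e_def)
  also have "1/4 * (2 * laplacian G g b) + sheet_sign t * sheet_sign s * of_bool (b = a) / 2
      = of_bool ((b, t) = (a, s)) - c b / 2"
    using pot b by (auto simp: grounded_potential_def sheet_sign_def field_simps)
  finally show "laplacian (strong_prism G) (\<lambda>p. g (fst p) / 4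
       + sheet_sign s * sheet_sign (snd p) * of_bool (fst p = a)
          / (4 * (real (card (neighbours G a)) + 1))) z = of_bool (z = (a, s)) - c (fst z) / 2"
    by (simp add: e_def z k_def[symmetric] mult_ac)
qed

section \<open>Potentials on the ladder\<close>

primrec column :: "ladder_vertex \<Rightarrow> nat" where
  "column (U i) = i"
| "column (V i) = i"

primrec row_sign :: "ladder_vertex \<Rightarrow> real" where
  "row_sign (U i) = 1"
| "row_sign (V i) = -1"

definition path_laplacian :: "nat \<Rightarrow> (nat \<Rightarrow> real) \<Rightarrow> nat \<Rightarrow> real" where
  "path_laplacian N h j =
    (if 1 < j then h j - h (j - 1) else 0) + (if j < N then h j - h (j + 1) else 0)"

lemma symcl_iff: "(x, y) \<in> symcl R \<longleftrightarrow> (x, y) \<in> R \<or> (y, x) \<in> R"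
  by (force simp: symcl_def)

lemma neighbours_polyomino_chain:
  assumes "1 \<le> i" "i \<le> n + 1"
  shows "neighbours (polyomino_chain n) (U i) =
      insert (V i) (U ` ((if 1 < i then {i - 1} else {}) \<union> (if i < n + 1 then {i + 1} else {})))"
    "neighbours (polyomino_chain n) (V i) =
      insert (U i) (V ` ((if 1 < i then {i - 1} else {}) \<union> (if i < n + 1 then {i + 1} else {})))"
  using assms
  by (auto simp: neighbours_def polyomino_chain_def symcl_iff)

lemma card_neighbours_polyomino_chain:
  assumes "a \<in> pverts (polyomino_chain n)"
  shows "card (neighbours (polyomino_chain n) a) \<le> 3"
proof -
  obtain i where i: "1 \<le> i" "i \<le> n + 1" "a = U i \<or> a = V i"
    using assms by (auto simp: polyomino_chain_def)
  then show ?thesis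
    by (auto simp: neighbours_polyomino_chain card_insert_if)
qed

text \<open>
  Reflection in the long axis of the ladder splits functions once more. Functions of the column see
  the path alone; for functions that change sign between the rows, the current through the rung
  adds the mass term \<open>2 * k\<close>.
\<close>

lemma laplacian_polyomino_chain:
  assumes "a \<in> pverts (polyomino_chain n)"
  shows "laplacian (polyomino_chain n) (\<lambda>z. h (column z)) a = path_laplacian (n + 1) h (column a)"
    and "laplacian (polyomino_chain n) (\<lambda>z. row_sign z * k (column z)) a
      = row_sign a * (path_laplacian (n + 1) k (column a) + 2 * k (column a))"
proof -
  obtain i where i: "1 \<le> i" "i \<le> n + 1" "a = U i \<or> a = V i"
    using assms by (auto simp: polyomino_chain_def)
  have d: "i - 1 \<noteq> i + 1" by simp
  show "laplacian (polyomino_chain n) (\<lambda>z. h (column z)) a = path_laplacian (n + 1) h (column a)"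
    using i(3) i(1,2) d
    by (auto simp: laplacian_neighbours neighbours_polyomino_chain path_laplacian_def)
  show "laplacian (polyomino_chain n) (\<lambda>z. row_sign z * k (column z)) a
      = row_sign a * (path_laplacian (n + 1) k (column a) + 2 * k (column a))"
    using i(3) i(1,2) d
    by (auto simp: laplacian_neighbours neighbours_polyomino_chain path_laplacian_def algebra_simps)
qed

text \<open>
  The sink, half at either end of the path, does not depend on \<open>i\<close>: the slope is \<open>1/2\<close> in
  absolute value on both sides of the source, so the unit current splits evenly.
\<close>

lemma path_laplacian_distance:
  assumes "i \<in> {1..N}" "j \<in> {1..N}"
  shows "path_laplacian N (\<lambda>j. - \<bar>real i - real j\<bar> / 2) j
    = of_bool (j = i) - (of_bool (j = 1) + of_bool (j = N)) / 2"
  using assms by (auto simp: path_laplacian_def of_nat_diff abs_if field_simps)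

text \<open>
  The recurrence says that \<open>path_laplacian N k + 2 * k\<close> vanishes in the interior of the path.
  The equal values at \<open>0\<close> and \<open>1\<close> encode the end of the path: an extra vertex at the
  potential of vertex \<open>1\<close> draws no current.
\<close>

fun ladder_growth :: "nat \<Rightarrow> real" where
  "ladder_growth 0 = 1"
| "ladder_growth (Suc 0) = 1"
| "ladder_growth (Suc (Suc m)) = 4 * ladder_growth (Suc m) - ladder_growth m"

lemma ladder_growth_bounds:
  "1 \<le> ladder_growth m \<and> ladder_growth m \<le> ladder_growth (Suc m)
    \<and> 3 * ladder_growth (Suc m) \<le> ladder_growth (Suc (Suc m))"
  by (induction m) auto

lemma ladder_growth_mono: "i \<le> j \<Longrightarrow> ladder_growth i \<le> ladder_growth j"
  by (rule lift_Suc_mono_le[of ladder_growth]) (use ladder_growth_bounds in blast)+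

lemma ladder_growth_recurrence:
  "1 \<le> j \<Longrightarrow> ladder_growth (j - 1) + ladder_growth (j + 1) = 4 * ladder_growth j"
  by (cases j) auto

text \<open>
  The mass term screens the source, so this potential stays bounded uniformly in the length of the
  path. As for a Sturm-Liouville operator, it is the product of the homogeneous solution \<open>a\<close>
  adapted to the left end and its mirror image \<open>b\<close> adapted to the right end, divided by their
  discrete Wronskian \<open>W\<close> at the source.
\<close>

lemma screened_path_potential:
  assumes i: "i \<in> {1..N}"
  obtains K where "\<And>j. j \<in> {1..N} \<Longrightarrow> path_laplacian N K j + 2 * K j = of_bool (j = i)"
    and "\<And>j. \<bar>K j\<bar> \<le> 1 / 2"
proof -
  define a where "a = ladder_growth"
  define b where "b j = a (N + 1 - j)" for j
  have pos: "a j > 0" "b j > 0" for j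
    using ladder_growth_bounds[of j] ladder_growth_bounds[of "N + 1 - j"] by (auto simp: a_def b_def)
  have mono: "a j \<le> a k" "b k \<le> b j" if "j \<le> k" for j k
    using that by (auto simp: a_def b_def intro!: ladder_growth_mono)
  have rec: "a (j - 1) + a (j + 1) = 4 * a j" if "j \<in> {1..N}" for j
    using that ladder_growth_recurrence[of j] by (auto simp: a_def)
  have recb: "b (j - 1) + b (j + 1) = 4 * b j" if "j \<in> {1..N}" for j
  proof -
    have "N + 1 - (j - 1) = (N + 1 - j) + 1" "N + 1 - (j + 1) = (N + 1 - j) - 1"
      using that by auto
    moreover have "N + 1 - j \<in> {1..N}" using that by auto
    ultimately show ?thesis using rec[of "N + 1 - j"] by (simp add: b_def)
  qed
  have ends: "a 0 = a 1" "b (N + 1) = b N"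
    by (auto simp: a_def b_def)
  define W where "W = a (i + 1) * b i - a i * b (i + 1)"
  \<comment> \<open>Growth by a factor of at least 3 towards the source on one side, monotonicity on the other.\<close>
  have W: "W \<ge> 2 * (a i * b i)"
  proof -
    have "3 * a i \<le> a (i + 1)"
      using ladder_growth_bounds[of "i - 1"] i unfolding a_def by (cases i) auto
    then have "3 * a i * b i \<le> a (i + 1) * b i"
      using pos by (simp add: mult_right_mono less_imp_le)
    moreover have "a i * b (i + 1) \<le> a i * b i"
      using mono(2)[of i "i + 1"] pos[of i] by simp
    ultimately show ?thesis by (simp add: W_def)
  qed
  have Wpos: "W > 0"
    using W mult_pos_pos[OF pos(1)[of i] pos(2)[of i]] by linarith
  define K where "K j = a (min i j) * b (max i j) / W" for j
  show thesis
  proof (rule that)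
    fix j
    have "a (min i j) * b (max i j) \<le> a i * b i"
      using pos mono by (intro mult_mono) (auto simp: less_imp_le)
    also have "\<dots> \<le> W / 2"
      using W by simp
    finally have "K j \<le> 1 / 2"
      using Wpos by (simp add: K_def field_simps)
    moreover have "K j \<ge> 0"
      using pos Wpos by (simp add: K_def less_imp_le)
    ultimately show "\<bar>K j\<bar> \<le> 1 / 2" by simp
  next
    fix j assume j: "j \<in> {1..N}"
    \<comment> \<open>Extending \<open>K\<close> by its end values to \<open>0\<close> and \<open>N + 1\<close> makes the equation uniform in \<open>j\<close>.\<close>
    have "path_laplacian N K j + 2 * K j = 4 * K j - K (j - 1) - K (j + 1)"
    proof -
      have "K 0 = K 1" "K (N + 1) = K N"
        using i ends by (auto simp: K_def min_def max_def)
      then show ?thesis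
        using j by (cases "j = 1"; cases "j = N") (auto simp: path_laplacian_def)
    qed
    also have "\<dots> = of_bool (j = i)"
    proof (cases j i rule: linorder_cases)
      case less
      then have "K j = a j * b i / W" "K (j - 1) = a (j - 1) * b i / W" "K (j + 1) = a (j + 1) * b i / W"
        by (simp_all add: K_def min_absorb2 max_absorb1)
      then have "4 * K j - K (j - 1) - K (j + 1) = (4 * a j - (a (j - 1) + a (j + 1))) * b i / W"
        by (simp add: algebra_simps diff_divide_distrib add_divide_distrib)
      then show ?thesis using rec[OF j] less by simp
    next
      case greater
      then have "K j = b j * a i / W" "K (j - 1) = b (j - 1) * a i / W" "K (j + 1) = b (j + 1) * a i / W"
        by (simp_all add: K_def min_absorb1 max_absorb2)
      then have "4 * K j - K (j - 1) - K (j + 1) = (4 * b j - (b (j - 1) + b (j + 1))) * a i / W"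
        by (simp add: algebra_simps diff_divide_distrib add_divide_distrib)
      then show ?thesis using recb[OF j] greater by simp
    next
      case equal
      then have "K j = a i * b i / W" "K (j - 1) = a (i - 1) * b i / W" "K (j + 1) = a i * b (i + 1) / W"
        by (simp_all add: K_def min_absorb1 min_absorb2 max_absorb1 max_absorb2)
      then have "4 * K j - K (j - 1) - K (j + 1) = ((4 * a i - a (i - 1)) * b i - a i * b (i + 1)) / W"
        by (simp add: algebra_simps diff_divide_distrib add_divide_distrib)
      also have "4 * a i - a (i - 1) = a (i + 1)"
        using rec[OF i] by simp
      finally show ?thesis using equal Wpos by (simp add: W_def)
    qed
    finally show "path_laplacian N K j + 2 * K j = of_bool (j = i)" .
  qed
qed

definition corner_distribution :: "nat \<Rightarrow> ladder_vertex \<Rightarrow> real" where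
  "corner_distribution n z = (of_bool (column z = 1) + of_bool (column z = n + 1)) / 4"

text \<open>
  The unit source at a vertex is half the source on its whole column plus half a source that changes
  sign between the rows. The first part gives the linear term, the second a bounded one.
\<close>

lemma grounded_potential_polyomino_chain:
  assumes x: "x \<in> pverts (polyomino_chain n)"
  obtains g where "grounded_potential (polyomino_chain n) (corner_distribution n) x g"
    and "\<And>z. \<bar>g z + \<bar>real (column x) - real (column z)\<bar> / 4\<bar> \<le> 1 / 4"
proof -
  have col: "column z \<in> {1..n + 1}" if "z \<in> pverts (polyomino_chain n)" for z
    using that by (auto simp: polyomino_chain_def)
  define i where "i = column x"
  obtain K where K: "\<And>j. j \<in> {1..n + 1} \<Longrightarrow> path_laplacian (n + 1) K j + 2 * K j = of_bool (j = i)"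
    and Kb: "\<And>j. \<bar>K j\<bar> \<le> 1 / 2"
    using screened_path_potential[OF col[OF x]] unfolding i_def by blast
  define h where "h j = - \<bar>real i - real j\<bar> / 2" for j
  \<comment> \<open>The factor \<open>row_sign x\<close> selects the row of the source.\<close>
  define g where "g z = 1/2 * h (column z) + row_sign x / 2 * (row_sign z * K (column z))" for z
  show thesis
  proof (rule that)
    show "grounded_potential (polyomino_chain n) (corner_distribution n) x g"
      unfolding grounded_potential_def
    proof
      fix z assume z: "z \<in> pverts (polyomino_chain n)"
      have "laplacian (polyomino_chain n) g z
          = 1/2 * path_laplacian (n + 1) h (column z)
            + row_sign x / 2 * (row_sign z * of_bool (column z = i))"
        unfolding g_def laplacian_add laplacian_mult laplacian_polyomino_chain[OF z] K[OF col[OF z]] ..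
      also have "path_laplacian (n + 1) h (column z)
          = of_bool (column z = i) - (of_bool (column z = 1) + of_bool (column z = n + 1)) / 2"
        unfolding h_def i_def by (rule path_laplacian_distance[OF col[OF x] col[OF z]])
      also have "1/2 * \<dots> + row_sign x / 2 * (row_sign z * of_bool (column z = i))
          = of_bool (z = x) - corner_distribution n z"
        unfolding i_def corner_distribution_def by (cases x; cases z) (auto simp: field_simps)
      finally show "laplacian (polyomino_chain n) g z = of_bool (z = x) - corner_distribution n z" .
    qed
  next
    fix z
    show "\<bar>g z + \<bar>real (column x) - real (column z)\<bar> / 4\<bar> \<le> 1 / 4"
      using Kb[of "column z"] by (cases x; cases z) (auto simp: g_def h_def i_def)
  qed
qed

section \<open>Degrees and distances in a graph\<close>

lemma out_degree_eq_card_neighbours: "out_degree (with_proj G) z = card (neighbours G z)"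
proof -
  have "out_arcs (with_proj G) z = Pair z ` neighbours G z"
    by (auto simp: out_arcs_def neighbours_def)
  then show ?thesis
    by (simp add: out_degree_def card_image inj_on_def)
qed

lemma (in pair_graph) out_degree_strong_prism:
  assumes "a \<in> pverts G"
  shows "out_degree (with_proj (strong_prism G)) (a, s) = 2 * card (neighbours G a) + 1"
  using sum_neighbours_strong_prism[OF assms, of "\<lambda>_. 1::nat" s]
  by (simp add: out_degree_eq_card_neighbours)

lemma (in pair_graph) mu_le_relpow:
  assumes "(x, y) \<in> parcs G ^^ k" "x \<in> pverts G"
  shows "\<mu> (\<lambda>_. 1) x y \<le> ereal (real k)"
proof -
  have "\<exists>p. awalk x p y \<and> awalk_cost (\<lambda>_. 1) p = real k"
    using assms
  proof (induction k arbitrary: y)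
    case 0
    then show ?case
      by (auto simp: awalk_Nil_iff intro!: exI[of _ "[]"])
  next
    case (Suc k)
    then obtain w p where "awalk x p w" "awalk_cost (\<lambda>_. 1) p = real k" and w: "(w, y) \<in> parcs G"
      by fastforce
    moreover have "awalk w [(w, y)] y"
      using arc_implies_awalk[of "(w, y)"] w by simp
    ultimately show ?case
      by (intro exI[of _ "p @ [(w, y)]"]) (auto intro: awalk_appendI)
  qed
  then obtain p where "awalk x p y" "awalk_cost (\<lambda>_. 1) p = real k"
    by blast
  then show ?thesis
    using min_cost_le_walk_cost[of x p y "\<lambda>_. 1"] by simp
qed

text \<open>
  A function that changes by at most one along every edge bounds the length of walks from below.
\<close>

lemma (in pair_graph) mu_ge_lipschitz:
  fixes f :: "'a \<Rightarrow> real"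
  assumes "\<And>z w. (z, w) \<in> parcs G \<Longrightarrow> \<bar>f z - f w\<bar> \<le> 1"
  shows "ereal \<bar>f x - f y\<bar> \<le> \<mu> (\<lambda>_. 1) x y"
proof -
  have "\<bar>f x - f y\<bar> \<le> awalk_cost (\<lambda>_. 1) p" if "awalk x p y" for p
    using that
  proof (induction p arbitrary: x)
    case Nil
    then show ?case by (simp add: awalk_Nil_iff)
  next
    case (Cons e p)
    then have "(x, snd e) \<in> parcs G" "awalk (snd e) p y"
      by (auto simp: awalk_Cons_iff)
    then have "\<bar>f x - f (snd e)\<bar> \<le> 1" "\<bar>f (snd e) - f y\<bar> \<le> awalk_cost (\<lambda>_. 1) p"
      using assms Cons.IH by blast+
    then show ?case by simp
  qed
  then show ?thesis
    unfolding \<mu>_def by (auto intro!: INF_greatest)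
qed

lemma (in pair_graph) graph_distance_between:
  fixes f :: "'a \<Rightarrow> real"
  assumes "\<And>z w. (z, w) \<in> parcs G \<Longrightarrow> \<bar>f z - f w\<bar> \<le> 1"
    and "(x, y) \<in> parcs G ^^ k" "x \<in> pverts G"
  shows "\<bar>f x - f y\<bar> \<le> graph_distance G x y" "graph_distance G x y \<le> real k"
proof -
  have "ereal \<bar>f x - f y\<bar> \<le> \<mu> (\<lambda>_. 1) x y" "\<mu> (\<lambda>_. 1) x y \<le> ereal (real k)"
    using mu_ge_lipschitz[of f, OF assms(1)] mu_le_relpow[OF assms(2,3)] by auto
  then show "\<bar>f x - f y\<bar> \<le> graph_distance G x y" "graph_distance G x y \<le> real k"
    unfolding graph_distance_def by (cases "\<mu> (\<lambda>_. 1) x y"; auto)+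
qed

section \<open>Distances and resistances in the prism of the ladder\<close>

abbreviation "prism_chain n \<equiv> strong_prism (polyomino_chain n)"

lemma neighbours_column:
  assumes "(z, w) \<in> parcs (prism_chain n)"
  shows "\<bar>real (column (fst z)) - real (column (fst w))\<bar> \<le> 1"
  using assms
  by (auto simp: strong_prism_def strong_product_def polyomino_chain_def symcl_iff)

lemma prism_chain_arcI:
  assumes "a \<in> pverts (polyomino_chain n)" "b \<in> pverts (polyomino_chain n)"
    "a = b \<or> (a, b) \<in> parcs (polyomino_chain n)" "a \<noteq> b \<or> s \<noteq> t"
  shows "((a, s), (b, t)) \<in> parcs (prism_chain n)"
  using assms by (auto simp: strong_prism_def strong_product_def complete_two_def)

lemma sym_prism_chain: "sym (parcs (prism_chain n))"
proof -
  interpret pair_graph "prism_chain n"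
    by (intro pair_graph_strong_prism pair_graph_polyomino_chain)
  show ?thesis
    using pair_sym_arcs by (simp add: symmetric_def)
qed

lemma prism_chain_horizontal:
  assumes "1 \<le> i" "i + k \<le> n + 1"
  shows "((U i, s), (U (i + k), s)) \<in> parcs (prism_chain n) ^^ k"
    "((V i, s), (V (i + k), s)) \<in> parcs (prism_chain n) ^^ k"
  using assms
proof (induction k)
  case (Suc k)
  {
    case 1
    then have "((U (i + k), s), (U (i + Suc k), s)) \<in> parcs (prism_chain n)"
      by (intro prism_chain_arcI) (auto simp: polyomino_chain_def symcl_iff)
    with 1 Suc show ?case by auto
  next
    case 2
    then have "((V (i + k), s), (V (i + Suc k), s)) \<in> parcs (prism_chain n)"
      by (intro prism_chain_arcI) (auto simp: polyomino_chain_def symcl_iff)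
    with 2 Suc show ?case by auto
  }
qed auto

text \<open>
  Walk along the row and the sheet of \<open>x\<close> to the column of \<open>y\<close>. The four vertices of a column
  are pairwise adjacent, since the strong product also has the diagonals, so one further step
  suffices.
\<close>

lemma prism_chain_walk_ordered:
  assumes x: "x \<in> pverts (prism_chain n)" and y: "y \<in> pverts (prism_chain n)"
    and le: "column (fst x) \<le> column (fst y)"
  shows "\<exists>k \<le> column (fst y) - column (fst x) + 1. (x, y) \<in> parcs (prism_chain n) ^^ k"
proof -
  obtain a s b t where xy: "x = (a, s)" "y = (b, t)"
    by (cases x; cases y)
  define i where "i = column a"
  define k where "k = column b - column a"
  have ik: "1 \<le> i" "i + k \<le> n + 1" "column b = i + k"
    using x y le by (auto simp: xy i_def k_def pverts_strong_prism polyomino_chain_def)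
  define c where "c = (case a of U _ \<Rightarrow> U (i + k) | V _ \<Rightarrow> V (i + k))"
  have "(x, (c, s)) \<in> parcs (prism_chain n) ^^ k"
    using prism_chain_horizontal[OF ik(1,2), of s] by (cases a) (auto simp: xy c_def i_def)
  moreover have "(c, s) = y \<or> ((c, s), y) \<in> parcs (prism_chain n)"
  proof (cases "(c, s) = y")
    case False
    have "b \<in> pverts (polyomino_chain n)" "c \<in> pverts (polyomino_chain n)"
      using y ik by (auto simp: xy c_def pverts_strong_prism polyomino_chain_def split: ladder_vertex.split)
    moreover have "c = b \<or> (c, b) \<in> parcs (polyomino_chain n)"
      using ik by (cases a; cases b) (auto simp: c_def polyomino_chain_def symcl_iff)
    ultimately have "((c, s), (b, t)) \<in> parcs (prism_chain n)"
      using False by (intro prism_chain_arcI) (auto simp: xy)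
    then show ?thesis by (simp add: xy)
  qed simp
  ultimately have "(x, y) \<in> parcs (prism_chain n) ^^ k \<or> (x, y) \<in> parcs (prism_chain n) ^^ (k + 1)"
    by auto
  then obtain m where "m \<le> k + 1" "(x, y) \<in> parcs (prism_chain n) ^^ m"
    by (metis le_add1 order_refl)
  then show ?thesis
    unfolding xy k_def by auto
qed

lemma sym_relpow:
  assumes "sym R"
  shows "sym (R ^^ k)"
proof (induction k)
  case (Suc k)
  show ?case
  proof (rule symI)
    fix x y assume "(x, y) \<in> R ^^ Suc k"
    then obtain w where "(x, w) \<in> R ^^ k" "(w, y) \<in> R"
      by auto
    then have "(w, x) \<in> R ^^ k" "(y, w) \<in> R"
      using Suc.IH assms by (auto dest: symD)
    then show "(y, x) \<in> R ^^ Suc k"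
      by (rule relpow_Suc_I2[rotated])
  qed
qed (simp add: sym_def)

lemma prism_chain_walk:
  assumes x: "x \<in> pverts (prism_chain n)" and y: "y \<in> pverts (prism_chain n)"
  obtains k where "(x, y) \<in> parcs (prism_chain n) ^^ k"
    and "real k \<le> \<bar>real (column (fst x)) - real (column (fst y))\<bar> + 1"
proof (cases "column (fst x) \<le> column (fst y)")
  case True
  from prism_chain_walk_ordered[OF x y this] obtain k where
    "k \<le> column (fst y) - column (fst x) + 1" "(x, y) \<in> parcs (prism_chain n) ^^ k"
    by blast
  with True show ?thesis
    by (intro that[of k]) auto
next
  case False
  then have le: "column (fst y) \<le> column (fst x)"
    by simp
  from prism_chain_walk_ordered[OF y x this] obtain k where
    k: "k \<le> column (fst x) - column (fst y) + 1" "(y, x) \<in> parcs (prism_chain n) ^^ k"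
    by blast
  then have "(x, y) \<in> parcs (prism_chain n) ^^ k"
    using sym_relpow[OF sym_prism_chain] by (metis symD)
  with k(1) le show ?thesis
    by (intro that[of k]) auto
qed

lemma prism_chain_distance:
  assumes x: "x \<in> pverts (prism_chain n)" and y: "y \<in> pverts (prism_chain n)"
  shows "\<bar>real (column (fst x)) - real (column (fst y))\<bar> \<le> graph_distance (prism_chain n) x y"
    and "graph_distance (prism_chain n) x y \<le> \<bar>real (column (fst x)) - real (column (fst y))\<bar> + 1"
proof -
  interpret pair_graph "prism_chain n"
    by (intro pair_graph_strong_prism pair_graph_polyomino_chain)
  obtain k where k: "(x, y) \<in> parcs (prism_chain n) ^^ k"
    "real k \<le> \<bar>real (column (fst x)) - real (column (fst y))\<bar> + 1"
    using prism_chain_walk[OF x y] .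
  note between = graph_distance_between
    [of "\<lambda>z. real (column (fst z))", OF neighbours_column[where n = n] k(1) x]
  show "\<bar>real (column (fst x)) - real (column (fst y))\<bar> \<le> graph_distance (prism_chain n) x y"
    by (rule between)
  show "graph_distance (prism_chain n) x y \<le> \<bar>real (column (fst x)) - real (column (fst y))\<bar> + 1"
    using between(2) k(2) by simp
qed

lemma grounded_potential_prism_chain:
  assumes x: "x \<in> pverts (prism_chain n)"
  obtains \<phi> where
    "grounded_potential (prism_chain n) (\<lambda>p. corner_distribution n (fst p) / 2) x \<phi>"
    and "\<And>z. \<bar>\<phi> z + \<bar>real (column (fst x)) - real (column (fst z))\<bar> / 16\<bar> \<le> 5 / 16"
proof -
  interpret pair_graph "polyomino_chain n"
    by (rule pair_graph_polyomino_chain)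
  obtain a s where xa: "x = (a, s)" and a: "a \<in> pverts (polyomino_chain n)"
    using x by (auto simp: pverts_strong_prism)
  obtain g where g: "grounded_potential (polyomino_chain n) (corner_distribution n) a g"
    and gb: "\<And>z. \<bar>g z + \<bar>real (column a) - real (column z)\<bar> / 4\<bar> \<le> 1 / 4"
    using grounded_potential_polyomino_chain[OF a] by blast
  define e where "e p = sheet_sign s * sheet_sign (snd p) * of_bool (fst p = a)
    / (4 * (real (card (neighbours (polyomino_chain n) a)) + 1))" for p
  have e: "\<bar>e p\<bar> \<le> 1 / 4" for p
    by (auto simp: e_def sheet_sign_def field_simps)
  show thesis
  proof (rule that)
    show "grounded_potential (prism_chain n) (\<lambda>p. corner_distribution n (fst p) / 2) x (\<lambda>p. g (fst p) / 4 + e p)"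
      unfolding xa e_def by (rule grounded_potential_strong_prism[OF g])
    fix z
    show "\<bar>g (fst z) / 4 + e z + \<bar>real (column (fst x)) - real (column (fst z))\<bar> / 16\<bar> \<le> 5 / 16"
    proof -
      define D where "D = \<bar>real (column a) - real (column (fst z))\<bar>"
      have "\<bar>g (fst z) + D / 4\<bar> \<le> 1 / 4"
        using gb[of "fst z"] by (simp add: D_def)
      then have "\<bar>g (fst z) / 4 + e z + D / 16\<bar> \<le> 5 / 16"
        using e[of z] by linarith
      then show ?thesis
        by (simp add: xa D_def)
    qed
  qed
qed

text \<open>
  Neighbouring columns are joined by eight parallel edges when each column is kept at a common
  potential, which is where the factor \<open>1/8\<close> comes from. The resistance is
  a signed sum of four values of grounded potentials, each with an error of at most \<open>5/16\<close>.
\<close>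

lemma prism_chain_resistance:
  assumes x: "x \<in> pverts (prism_chain n)" and y: "y \<in> pverts (prism_chain n)"
  shows "\<bar>resistance_distance (prism_chain n) x y - \<bar>real (column (fst x)) - real (column (fst y))\<bar> / 8\<bar>
    \<le> 5 / 4"
proof -
  interpret pair_graph "prism_chain n"
    by (intro pair_graph_strong_prism pair_graph_polyomino_chain)
  have conn: "(u, v) \<in> (parcs (prism_chain n))\<^sup>*"
    if "u \<in> pverts (prism_chain n)" "v \<in> pverts (prism_chain n)" for u v
    using prism_chain_walk[OF that] relpow_imp_rtrancl by metis
  obtain \<phi> where \<phi>: "grounded_potential (prism_chain n) (\<lambda>p. corner_distribution n (fst p) / 2) x \<phi>"
    and \<phi>b: "\<And>z. \<bar>\<phi> z + \<bar>real (column (fst x)) - real (column (fst z))\<bar> / 16\<bar> \<le> 5 / 16"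
    using grounded_potential_prism_chain[OF x] by blast
  obtain \<psi> where \<psi>: "grounded_potential (prism_chain n) (\<lambda>p. corner_distribution n (fst p) / 2) y \<psi>"
    and \<psi>b: "\<And>z. \<bar>\<psi> z + \<bar>real (column (fst y)) - real (column (fst z))\<bar> / 16\<bar> \<le> 5 / 16"
    using grounded_potential_prism_chain[OF y] by blast
  have r: "resistance_distance (prism_chain n) x y = (\<phi> x - \<psi> x) - (\<phi> y - \<psi> y)"
    by (rule resistance_distance_eqI[OF conn x y unit_current_potential_superposition[OF \<phi> \<psi>]])
  define D where "D = \<bar>real (column (fst x)) - real (column (fst y))\<bar>"
  have "\<bar>\<phi> x\<bar> \<le> 5 / 16" "\<bar>\<phi> y + D / 16\<bar> \<le> 5 / 16" "\<bar>\<psi> x + D / 16\<bar> \<le> 5 / 16" "\<bar>\<psi> y\<bar> \<le> 5 / 16"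
    using \<phi>b[of x] \<phi>b[of y] \<psi>b[of x] \<psi>b[of y]
    by (simp_all add: D_def abs_minus_commute[of "real (column (fst y))"])
  then have "\<bar>(\<phi> x - \<psi> x) - (\<phi> y - \<psi> y) - D / 8\<bar> \<le> 5 / 4"
    by linarith
  then show ?thesis
    unfolding r D_def .
qed

lemma prism_chain_degree:
  assumes "x \<in> pverts (prism_chain n)"
  shows "1 \<le> out_degree (with_proj (prism_chain n)) x" "out_degree (with_proj (prism_chain n)) x \<le> 7"
proof -
  interpret pair_graph "polyomino_chain n"
    by (rule pair_graph_polyomino_chain)
  obtain a s where xa: "x = (a, s)" and a: "a \<in> pverts (polyomino_chain n)"
    using assms by (auto simp: pverts_strong_prism)
  show "1 \<le> out_degree (with_proj (prism_chain n)) x" "out_degree (with_proj (prism_chain n)) x \<le> 7"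
    using card_neighbours_polyomino_chain[OF a] by (auto simp: xa out_degree_strong_prism[OF a])
qed

lemma card_pverts_prism_chain: "card (pverts (prism_chain n)) = 4 * (n + 1)"
proof -
  have "card (pverts (polyomino_chain n)) = 2 * (n + 1)"
    unfolding polyomino_chain_def pair_pre_digraph.simps
    by (subst card_Un_disjoint) (auto simp: card_image inj_on_def)
  then show ?thesis
    by (simp add: pverts_strong_prism card_cartesian_product)
qed

section \<open>Comparison of the two indices\<close>

text \<open>
  Each pair contributes at most \<open>7 * 7 * 3/2\<close>: the resistance error \<open>5/4\<close> plus an eighth
  of the distance error \<open>1\<close> is below \<open>3/2\<close>. There are at most
  \<open>(4 * (n + 1))^2 / 2\<close> pairs.
\<close>

lemma Kirchhoff_minus_Gutman_prism_chain:
  "\<bar>degree_Kirchhoff_index (prism_chain n) - Gutman_index (prism_chain n) / 8\<bar>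
    \<le> 588 * (real n + 1) ^ 2"
proof -
  define P where "P = pverts (prism_chain n)"
  define d where "d x = real (out_degree (with_proj (prism_chain n)) x)" for x
  define r where "r = resistance_distance (prism_chain n)"
  define \<delta> where "\<delta> = graph_distance (prism_chain n)"
  have fin: "finite P"
    unfolding P_def by (rule card_ge_0_finite) (simp add: card_pverts_prism_chain)
  have pair: "\<bar>d x * d y * r x y - d x * d y * \<delta> x y / 8\<bar> \<le> 147 / 2" if "x \<in> P" "y \<in> P" for x y
  proof -
    have "\<bar>r x y - \<delta> x y / 8\<bar> \<le> 3 / 2"
    proof -
      define D where "D = \<bar>real (column (fst x)) - real (column (fst y))\<bar>"
      have "\<bar>r x y - D / 8\<bar> \<le> 5 / 4" "D \<le> \<delta> x y" "\<delta> x y \<le> D + 1"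
        using prism_chain_resistance[of x n y] prism_chain_distance[of x n y] that
        unfolding r_def \<delta>_def P_def D_def by blast+
      then show ?thesis
        by linarith
    qed
    moreover have d: "0 \<le> d x" "d x \<le> 7" "0 \<le> d y" "d y \<le> 7"
      using prism_chain_degree(2)[of x n] prism_chain_degree(2)[of y n] that
      unfolding d_def P_def by auto
    then have "0 \<le> d x * d y" "d x * d y \<le> 7 * 7"
      using mult_mono[of "d x" 7 "d y" 7] by auto
    ultimately have "d x * d y * \<bar>r x y - \<delta> x y / 8\<bar> \<le> (7 * 7) * (3 / 2)"
      by - (rule mult_mono, auto)
    moreover have "d x * d y * r x y - d x * d y * \<delta> x y / 8 = d x * d y * (r x y - \<delta> x y / 8)"
      by (simp add: algebra_simps)
    ultimately show ?thesis
      using d by (simp add: abs_mult)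
  qed
  have diff: "degree_Kirchhoff_index (prism_chain n) - Gutman_index (prism_chain n) / 8
      = (\<Sum>x\<in>P. \<Sum>y\<in>P - {x}. d x * d y * r x y - d x * d y * \<delta> x y / 8) / 2"
    unfolding degree_Kirchhoff_index_def Gutman_index_def sum_vertex_pairs_def
    unfolding P_def[symmetric] d_def[symmetric] r_def[symmetric] \<delta>_def[symmetric]
    by (simp add: sum_subtractf sum_divide_distrib[symmetric] diff_divide_distrib)
  have "\<bar>\<Sum>x\<in>P. \<Sum>y\<in>P - {x}. d x * d y * r x y - d x * d y * \<delta> x y / 8\<bar>
      \<le> real (card P) * (real (card P) * (147 / 2))"
  proof -
    have "\<bar>\<Sum>y\<in>P - {x}. d x * d y * r x y - d x * d y * \<delta> x y / 8\<bar> \<le> real (card P) * (147 / 2)"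
      if "x \<in> P" for x
    proof -
      have "\<bar>\<Sum>y\<in>P - {x}. d x * d y * r x y - d x * d y * \<delta> x y / 8\<bar>
          \<le> (\<Sum>y\<in>P - {x}. 147 / 2)"
        using pair that by (intro order_trans[OF sum_abs sum_mono]) auto
      also have "\<dots> \<le> (\<Sum>y\<in>P. 147 / 2)"
        using fin by (intro sum_mono2) auto
      finally show ?thesis by simp
    qed
    then have "\<bar>\<Sum>x\<in>P. \<Sum>y\<in>P - {x}. d x * d y * r x y - d x * d y * \<delta> x y / 8\<bar>
        \<le> (\<Sum>x\<in>P. real (card P) * (147 / 2))"
      by (intro order_trans[OF sum_abs sum_mono])
    then show ?thesis by simp
  qed
  moreover have "real (card P) = 4 * (real n + 1)"
    by (simp add: P_def card_pverts_prism_chain)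
  ultimately show ?thesis
    unfolding diff by (simp add: power2_eq_square algebra_simps)
qed

lemma sum_abs_diff_interval:
  "(\<Sum>i\<in>{1..N}. \<Sum>j\<in>{1..N}. \<bar>real i - real j\<bar>) = (real N ^ 3 - real N) / 3"
proof (induction N)
  case (Suc N)
  have last: "(\<Sum>j\<in>{1..N}. real (Suc N) - real j) = real N * (real N + 1) / 2"
    by (induction N) (auto simp: field_simps sum_subtractf)
  have "(\<Sum>i\<in>{1..Suc N}. \<Sum>j\<in>{1..Suc N}. \<bar>real i - real j\<bar>)
      = (\<Sum>i\<in>{1..N}. \<Sum>j\<in>{1..N}. \<bar>real i - real j\<bar>)
        + (\<Sum>i\<in>{1..N}. \<bar>real i - real (Suc N)\<bar>) + (\<Sum>j\<in>{1..N}. \<bar>real (Suc N) - real j\<bar>)"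
    by (simp add: sum.distrib)
  also have "(\<Sum>i\<in>{1..N}. \<bar>real i - real (Suc N)\<bar>) = (\<Sum>j\<in>{1..N}. real (Suc N) - real j)"
    by (intro sum.cong) auto
  also have "(\<Sum>j\<in>{1..N}. \<bar>real (Suc N) - real j\<bar>) = (\<Sum>j\<in>{1..N}. real (Suc N) - real j)"
    by (intro sum.cong) auto
  finally show ?case
    unfolding Suc.IH last by (simp add: power3_eq_cube field_simps)
qed simp

text \<open>
  Cubic growth already comes from the pairs within one row of one sheet.
\<close>

lemma Gutman_index_prism_chain_lower:
  "((real n + 1) ^ 3 - (real n + 1)) / 6 \<le> Gutman_index (prism_chain n)"
proof -
  define P where "P = pverts (prism_chain n)"
  define d where "d x = real (out_degree (with_proj (prism_chain n)) x)" for x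
  define \<delta> where "\<delta> = graph_distance (prism_chain n)"
  define h where "h x y = \<bar>real (column (fst x)) - real (column (fst y))\<bar>" for x y :: "ladder_vertex \<times> bool"
  define \<iota> where "\<iota> i = (U i, True)" for i
  have fin: "finite P"
    unfolding P_def by (rule card_ge_0_finite) (simp add: card_pverts_prism_chain)
  have \<iota>: "\<iota> ` {1..n + 1} \<subseteq> P" "inj \<iota>"
    by (auto simp: \<iota>_def P_def pverts_strong_prism polyomino_chain_def inj_on_def)
  have restrict: "(\<Sum>i\<in>{1..n + 1}. f (\<iota> i)) \<le> sum f P" if "\<And>x. f x \<ge> 0" for f :: "_ \<Rightarrow> real"
  proof -
    have "(\<Sum>i\<in>{1..n + 1}. f (\<iota> i)) = sum f (\<iota> ` {1..n + 1})"
      using \<iota>(2) by (subst sum.reindex) (auto intro: inj_on_subset)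
    also have "\<dots> \<le> sum f P"
      using fin \<iota>(1) that by (intro sum_mono2) auto
    finally show ?thesis .
  qed
  have pair: "h x y \<le> d x * d y * \<delta> x y" if "x \<in> P" "y \<in> P" for x y
  proof -
    have "1 \<le> d x" "1 \<le> d y"
      using prism_chain_degree(1) that by (auto simp: P_def d_def)
    then have "1 * 1 \<le> d x * d y"
      by (intro mult_mono) auto
    moreover have "h x y \<le> \<delta> x y" "0 \<le> h x y"
      using prism_chain_distance(1) that by (auto simp: P_def h_def \<delta>_def)
    ultimately have "1 * h x y \<le> d x * d y * \<delta> x y"
      by (intro mult_mono) auto
    then show ?thesis by simp
  qed
  have "((real n + 1) ^ 3 - (real n + 1)) / 3 = (\<Sum>i\<in>{1..n + 1}. \<Sum>j\<in>{1..n + 1}. h (\<iota> i) (\<iota> j))"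
    using sum_abs_diff_interval[of "n + 1"] by (simp add: h_def \<iota>_def add.commute)
  also have "\<dots> \<le> (\<Sum>i\<in>{1..n + 1}. \<Sum>y\<in>P. h (\<iota> i) y)"
    by (intro sum_mono restrict) (simp add: h_def)
  also have "\<dots> \<le> (\<Sum>x\<in>P. \<Sum>y\<in>P. h x y)"
    by (intro restrict sum_nonneg) (simp add: h_def)
  also have "\<dots> = (\<Sum>x\<in>P. \<Sum>y\<in>P - {x}. h x y)"
    using fin by (intro sum.cong refl sum.mono_neutral_right) (auto simp: h_def)
  also have "\<dots> \<le> (\<Sum>x\<in>P. \<Sum>y\<in>P - {x}. d x * d y * \<delta> x y)"
    using pair by (intro sum_mono) auto
  finally show ?thesis
    unfolding Gutman_index_def sum_vertex_pairs_def P_def[symmetric] d_def[symmetric] \<delta>_def[symmetric]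
    by simp
qed

theorem theorem3p7:
  shows "(\<lambda>n. degree_Kirchhoff_index (strong_prism (polyomino_chain n))
            / Gutman_index (strong_prism (polyomino_chain n))) \<longlonglongrightarrow> 1 / 8"
proof -
  have bound: "norm (degree_Kirchhoff_index (prism_chain n) / Gutman_index (prism_chain n) - 1 / 8)
      \<le> 7056 / real (Suc n)" if "1 \<le> n" for n
  proof -
    define N where "N = real n + 1"
    define G where "G = Gutman_index (prism_chain n)"
    define K where "K = degree_Kirchhoff_index (prism_chain n)"
    have N: "N \<ge> 2"
      using that by (simp add: N_def)
    then have "N * 2 \<le> N * N ^ 2"
      using power_mono[of 2 N 2] by (intro mult_left_mono) auto
    then have "N ^ 3 / 12 \<le> (N ^ 3 - N) / 6"
      by (simp add: power2_eq_square power3_eq_cube)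
    also have "\<dots> \<le> G"
      using Gutman_index_prism_chain_lower[of n] by (simp add: N_def G_def)
    finally have G: "N ^ 3 / 12 \<le> G" .
    then have Gpos: "G > 0"
      using N by (smt (verit) divide_pos_pos zero_less_power)
    have "norm (K / G - 1 / 8) = \<bar>K - G / 8\<bar> / G"
    proof -
      have "K / G - 1 / 8 = (K - G / 8) / G"
        using Gpos by (simp add: field_simps)
      then show ?thesis
        using Gpos by simp
    qed
    also have "\<dots> \<le> (588 * N ^ 2) / (N ^ 3 / 12)"
      using Kirchhoff_minus_Gutman_prism_chain[of n] G N
      by (intro frac_le) (auto simp: N_def G_def K_def)
    also have "\<dots> = 7056 / N"
      using N by (simp add: power2_eq_square power3_eq_cube)
    finally show ?thesis
      by (simp add: N_def G_def K_def add.commute)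
  qed
  have "(\<lambda>n. 7056 / real (Suc n)) \<longlonglongrightarrow> 0"
    by (rule LIMSEQ_Suc[OF lim_const_over_n])
  then have "(\<lambda>n. degree_Kirchhoff_index (prism_chain n) / Gutman_index (prism_chain n) - 1 / 8)
      \<longlonglongrightarrow> 0"
    by (rule tendsto_0_le[where K = 1]) (use bound in \<open>auto simp: eventually_sequentially\<close>)
  then show ?thesis
    by (rule LIM_zero_cancel)
qed

end
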